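(* Let $n \ge 1$ and $p \ge 4n$ be integers, and let $X$ be a nonnegative integer with $0 \le X < 2^p$. Let $D_C, D_S$ be the pair of $2n$-bit vectors to which the first part of the residue generator (the carry-save adder tree mod $2^{2n}-1$ described in the context) reduces $X$, let $D_{C,H}, D_{C,L}, D_{S,H}, D_{S,L}$ be their $n$-bit halves, so that $D_C = 2^n D_{C,H} + D_{C,L}$ and $D_S = 2^n D_{S,H} + D_{S,L}$, and let $X^*$ be the $(n+1)$-bit output of the residue generator mod $2^n+1$ described in the context. Then $$\left| X \right|_{2^n+1} = \left| D_{C,L} - D_{C,H} + D_{S,L} - D_{S,H} \right|_{2^n+1} = \left| X^* + 1 \right|_{2^n+1}$$ and $$\left| X - 1 \right|_{2^n+1} = X^* .$$
   Context: Notation: for an integer $a$ and a positive integer $m$, $|a|_m$ is the unique element of $\{0,1,\dots,m-1\}$ congruent to $a$ modulo $m$. Bit vectors are identified with the nonnegative integers they represent in binary. For an $n$-bit vector $B$, $\bar B = 2^n - 1 - B$ is its bitwise complement; for a bit $a \in \{0,1\}$, $\bar a = 1-a$. The residue generator mod $2^n+1$ (a circuit with a $p$-bit input $X$ and an $(n+1)$-bit output $X^*$) operates as follows. (1) First part: carry-save adder tree mod $2^{2n}-1$. Put $q = \lceil p/(2n) \rceil$ and split $X$ (padded with leading zeros to $2nq$ bits) into $2n$-bit blocks $D_0, \dots, D_{q-1}$ starting from the least significant bits, so $X = \sum_{j=0}^{q-1} 2^{2nj} D_j$ with $0 \le D_j < 2^{2n}$. A $q$-operand $2n$-bit carry-save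 adder tree with end-around carry reduces these blocks to two $2n$-bit vectors $D_C, D_S$ (so $0 \le D_C, D_S < 2^{2n}$) satisfying $$\left| \sum_{j=0}^{q-1} D_j \right|_{2^{2n}-1} = \left| D_C + D_S \right|_{2^{2n}-1}.$$ This equation is the only property of the tree to be used; $D_C, D_S$ may be any pair of $2n$-bit vectors satisfying it (if $p=4n$ the tree is absent and $D_C, D_S$ are the two blocks themselves). Each of $D_C, D_S$ is split into its $n$ most significant bits (index $H$) and $n$ least significant bits (index $L$). (2) Carry-save adder (CSA) stage mod $2^n+1$ with inverted end-around carry. For $n$-bit inputs $x, y, z$, let $s = (s_{n-1} \ldots s_0)$ and $c = (c_{n-1} \ldots c_0)$ be the bitwise sum and carry vectors, i.e. $x_i + y_i + z_i = 2c_i + s_i$ for $0 \le i < n$. The stage outputs the two $n$-bit vectors $s$ and $(c_{n-2} \ldots c_0 \, \bar c_{n-1})$, the latter having value $2 \sum_{i=0}^{n-2} c_i 2^i + \bar c_{n-1}$. (3) The first CSA stage is applied to $D_{C,L}, \bar D_{C,H}, D_{S,L}$ and outputs two $n$-bit vectors $D_{C,1}, D_{C,2}$. The second CSA stage is applied to $D_{C,1}, D_{C,2}, \bar D_{S,H}$ and outputs two $n$-bit vectors $D_{C,3}, D_{C,4}$. (4) Final adder with inverted end-around carry. Write $D_{C,3} + D_{C,4} = 2^n c_{\mathrm{out}} + s$ with $c_{\mathrm{out}} \in \{0,1\}$ and $0 \le s < 2^n$. The output is $X^* = s + \bar c_{\mathrm{out}}$, regarded as an $(n+1)$-bit numbe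r. *)

theory Defs
  imports Complex_Main
begin

text \<open>
  Bit vectors are the natural numbers they represent; the residue of \<open>a\<close> modulo \<open>m > 0\<close>
  is \<open>a mod m\<close> on \<^typ>\<open>int\<close>, which lies between \<open>0\<close> and \<open>m - 1\<close> also for negative \<open>a\<close>.
\<close>

definition complement :: "nat \<Rightarrow> nat \<Rightarrow> nat" where
  "complement n B = 2 ^ n - 1 - B"

definition low_half :: "nat \<Rightarrow> nat \<Rightarrow> nat" where
  "low_half n D = D mod 2 ^ n"

definition high_half :: "nat \<Rightarrow> nat \<Rightarrow> nat" where
  "high_half n D = D div 2 ^ n"

definition num_blocks :: "nat \<Rightarrow> nat \<Rightarrow> nat" where
  "num_blocks n p = nat \<lceil>real p / real (2 * n)\<rceil>"

definition block :: "nat \<Rightarrow> nat \<Rightarrow> nat \<Rightarrow> nat" where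
  "block n X j = (X div 2 ^ (2 * n * j)) mod 2 ^ (2 * n)"

text \<open>
  The carry-save adder tree modulo \<open>2 ^ (2 * n) - 1\<close> is specified only by the congruence its
  outputs satisfy, so it is a relation: any pair of \<open>2 * n\<close>-bit vectors with this property is
  admitted. For \<open>p = 4 * n\<close> this includes the pair of the two blocks themselves.
\<close>

definition csa_tree :: "nat \<Rightarrow> nat \<Rightarrow> nat \<Rightarrow> nat \<Rightarrow> nat \<Rightarrow> bool" where
  "csa_tree n p X D_C D_S \<longleftrightarrow>
     D_C < 2 ^ (2 * n) \<and> D_S < 2 ^ (2 * n) \<and>
     int (\<Sum>j<num_blocks n p. block n X j) mod (2 ^ (2 * n) - 1) =
       int (D_C + D_S) mod (2 ^ (2 * n) - 1)"

text \<open>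
  \<open>sum_bit x y z i\<close> and \<open>carry_bit x y z i\<close> are the unique bits \<open>s\<close>, \<open>c\<close> with
  \<open>x\<^sub>i + y\<^sub>i + z\<^sub>i = 2 * c + s\<close>.
\<close>

definition column :: "nat \<Rightarrow> nat \<Rightarrow> nat \<Rightarrow> nat \<Rightarrow> nat" where
  "column x y z i = of_bool (bit x i) + of_bool (bit y i) + of_bool (bit z i)"

definition sum_bit :: "nat \<Rightarrow> nat \<Rightarrow> nat \<Rightarrow> nat \<Rightarrow> nat" where
  "sum_bit x y z i = column x y z i mod 2"

definition carry_bit :: "nat \<Rightarrow> nat \<Rightarrow> nat \<Rightarrow> nat \<Rightarrow> nat" where
  "carry_bit x y z i = column x y z i div 2"

definition csa_stage :: "nat \<Rightarrow> nat \<Rightarrow> nat \<Rightarrow> nat \<Rightarrow> nat \<times> nat" where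
  "csa_stage n x y z =
     ((\<Sum>i<n. sum_bit x y z i * 2 ^ i),
      2 * (\<Sum>i<n - 1. carry_bit x y z i * 2 ^ i) + (1 - carry_bit x y z (n - 1)))"

text \<open>
  For \<open>a, b < 2 ^ n\<close> the carry-out \<open>(a + b) div 2 ^ n\<close> is a bit.
\<close>

definition final_adder :: "nat \<Rightarrow> nat \<Rightarrow> nat \<Rightarrow> nat" where
  "final_adder n a b = (a + b) mod 2 ^ n + (1 - (a + b) div 2 ^ n)"

definition residue_output :: "nat \<Rightarrow> nat \<Rightarrow> nat \<Rightarrow> nat" where
  "residue_output n D_C D_S =
     (let (D_C1, D_C2) =
            csa_stage n (low_half n D_C) (complement n (high_half n D_C)) (low_half n D_S);
          (D_C3, D_C4) = csa_stage n D_C1 D_C2 (complement n (high_half n D_S))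
      in final_adder n D_C3 D_C4)"

end

theory Submission
  imports Defs "HOL-Number_Theory.Cong"
begin

text \<open>
  Since \<open>2 ^ n\<close> is congruent to \<open>- 1\<close>, moving a carry of weight \<open>2 ^ n\<close> to an inverted bit of
  weight \<open>1\<close> increases the value by exactly \<open>1\<close> modulo \<open>2 ^ n + 1\<close>. This happens in both
  carry-save stages and in the final adder, for a total of \<open>3\<close>, while complementing the two high
  halves replaces \<open>- D\<close> by \<open>2 ^ n - 1 - D\<close>, which is congruent to \<open>- D - 2\<close>. So the output is
  congruent to the alternating sum of the halves plus \<open>3 - 4 = - 1\<close>, and it is at most \<open>2 ^ n\<close>.
\<close>

section \<open>Binary digits and the carry-save stage\<close>

lemma sum_bits_eq_mod:
  "(\<Sum>i<n. of_bool (bit (x::nat) i) * 2 ^ i) = x mod 2 ^ n"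
proof (induction n)
  case (Suc n)
  have "take_bit (Suc n) x = 2 ^ n * of_bool (bit x n) + take_bit n x"
    by (rule take_bit_Suc_from_most)
  with Suc show ?case by (simp add: take_bit_eq_mod)
qed simp

lemma sum_digits_less:
  fixes b :: "nat \<Rightarrow> nat"
  assumes "\<And>i. b i \<le> 1"
  shows "(\<Sum>i<n. b i * 2 ^ i) < 2 ^ n"
proof (induction n)
  case (Suc n)
  have "b n * 2 ^ n \<le> 1 * 2 ^ n" using assms by (rule mult_right_mono) simp
  with Suc show ?case unfolding sum.lessThan_Suc power_Suc by linarith
qed simp

lemma sum_bit_le_1: "sum_bit x y z i \<le> 1"
  by (simp add: sum_bit_def)

lemma carry_bit_le_1: "carry_bit x y z i \<le> 1"
  by (simp add: carry_bit_def column_def)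

text \<open>Each column obeys \<open>s + 2 * c = column\<close>; weighting by \<open>2 ^ i\<close>
  and summing recovers the operands, whose bits all lie below position \<open>n\<close>.\<close>

lemma sum_columns:
  assumes "x < 2 ^ n" "y < 2 ^ n" "z < 2 ^ n"
  shows "(\<Sum>i<n. sum_bit x y z i * 2 ^ i) + 2 * (\<Sum>i<n. carry_bit x y z i * 2 ^ i) = x + y + z"
proof -
  have "sum_bit x y z i * 2 ^ i + 2 * (carry_bit x y z i * 2 ^ i)
      = of_bool (bit x i) * 2 ^ i + of_bool (bit y i) * 2 ^ i + of_bool (bit z i) * 2 ^ i" for i
  proof -
    have "sum_bit x y z i + 2 * carry_bit x y z i
        = of_bool (bit x i) + of_bool (bit y i) + of_bool (bit z i)"
      unfolding sum_bit_def carry_bit_def column_def[symmetric] by simp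
    then show ?thesis by (metis add_mult_distrib mult.assoc)
  qed
  then have "(\<Sum>i<n. sum_bit x y z i * 2 ^ i + 2 * (carry_bit x y z i * 2 ^ i))
      = (\<Sum>i<n. of_bool (bit x i) * 2 ^ i + of_bool (bit y i) * 2 ^ i + of_bool (bit z i) * 2 ^ i)"
    by simp
  then show ?thesis
    using assms by (simp add: sum.distrib sum_distrib_left[symmetric] sum_bits_eq_mod)
qed

text \<open>The carry vector is twice a number below \<open>2 ^ (n - 1)\<close> plus one bit in the
  vacated lowest position. These bounds allow the outputs to feed the next stage or the final
  adder.\<close>

lemma csa_stage_less:
  assumes "n \<ge> 1" "csa_stage n x y z = (s, c)"
  shows "s < 2 ^ n" "c < 2 ^ n"
proof -
  show "s < 2 ^ n"
    using assms sum_digits_less[of "sum_bit x y z" n, OF sum_bit_le_1] by (auto simp: csa_stage_def)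
  have "(\<Sum>i<n - 1. carry_bit x y z i * 2 ^ i) < 2 ^ (n - 1)"
    by (rule sum_digits_less) (rule carry_bit_le_1)
  moreover have "(2::nat) ^ n = 2 * 2 ^ (n - 1)"
    using assms(1) by (metis One_nat_def Suc_le_lessD power_minus_mult mult.commute)
  moreover have "c = 2 * (\<Sum>i<n - 1. carry_bit x y z i * 2 ^ i) + (1 - carry_bit x y z (n - 1))"
    using assms(2) by (auto simp: csa_stage_def)
  ultimately show "c < 2 ^ n" by linarith
qed

lemma csa_stage_cong:
  assumes "n \<ge> 1" "x < 2 ^ n" "y < 2 ^ n" "z < 2 ^ n" "csa_stage n x y z = (s, c)"
  shows "[int s + int c = int x + int y + int z + 1] (mod 2 ^ n + 1)"
proof -
  obtain m where m: "n = Suc m" using assms(1) by (cases n) auto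
  define t where "t = carry_bit x y z m"
  have t: "t \<le> 1" unfolding t_def by (rule carry_bit_le_1)
  have "s + 2 * ((\<Sum>i<m. carry_bit x y z i * 2 ^ i) + t * 2 ^ m) = x + y + z"
    using sum_columns[OF assms(2-4)] assms(5) by (auto simp: csa_stage_def m t_def)
  moreover have "c = 2 * (\<Sum>i<m. carry_bit x y z i * 2 ^ i) + (1 - t)"
    using assms(5) by (auto simp: csa_stage_def m t_def)
  \<comment> \<open>Stated without subtraction: \<open>t \<le> 1\<close> makes the truncated
    \<open>1 - t\<close> exact, and the two \<open>t\<close> terms combine to a multiple of the
    modulus.\<close>
  ultimately have "s + c + t * 2 ^ n + t = x + y + z + 1"
    using t by (simp add: m algebra_simps)
  then have "int (s + c + t * 2 ^ n + t) = int (x + y + z + 1)" by (simp only:)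
  then have "int x + int y + int z + 1 = int s + int c + (2 ^ n + 1) * int t"
    by (simp add: algebra_simps)
  then show ?thesis by (simp add: cong_def)
qed

section \<open>The final adder\<close>

lemma final_adder_le:
  assumes "a < 2 ^ n" "b < 2 ^ n"
  shows "final_adder n a b \<le> 2 ^ n"
proof -
  \<comment> \<open>The inverted carry adds at most 1; the bound \<open>2 ^ n\<close> is attained
    when \<open>a + b = 2 ^ n - 1\<close>.\<close>
  have "(a + b) mod 2 ^ n < 2 ^ n" by simp
  then show ?thesis unfolding final_adder_def by linarith
qed

lemma final_adder_cong:
  assumes "a < 2 ^ n" "b < 2 ^ n"
  shows "[int (final_adder n a b) = int a + int b + 1] (mod 2 ^ n + 1)"
proof -
  define t where "t = (a + b) div 2 ^ n"
  have "t < 2" unfolding t_def using assms by (simp add: less_mult_imp_div_less)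
  moreover have "(a + b) mod 2 ^ n + 2 ^ n * t = a + b"
    unfolding t_def by simp
  ultimately have "final_adder n a b + 2 ^ n * t + t = a + b + 1"
    unfolding final_adder_def t_def[symmetric] by simp
  then have "int (final_adder n a b + 2 ^ n * t + t) = int (a + b + 1)" by (simp only:)
  then have "int a + int b + 1 = int (final_adder n a b) + (2 ^ n + 1) * int t"
    by (simp add: algebra_simps)
  then show ?thesis by (simp add: cong_def)
qed

section \<open>Complements, halves and the whole circuit\<close>

lemma int_complement:
  assumes "B < 2 ^ n"
  shows "int (complement n B) = 2 ^ n - 1 - int B"
  using assms by (simp add: complement_def of_nat_diff)

lemma complement_less: "complement n B < 2 ^ n"
  by (simp add: complement_def less_imp_diff_less)

lemma high_half_less:
  assumes "D < 2 ^ (2 * n)"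
  shows "high_half n D < 2 ^ n"
  using assms by (simp add: high_half_def less_mult_imp_div_less mult_2 power_add)

lemma low_half_less: "low_half n D < 2 ^ n"
  by (simp add: low_half_def)

lemma residue_output_le:
  assumes "n \<ge> 1"
  shows "residue_output n D_C D_S \<le> 2 ^ n"
  using csa_stage_less[OF assms] by (auto simp: residue_output_def intro: final_adder_le split: prod.splits)

lemma residue_output_cong:
  assumes n: "n \<ge> 1" and "D_C < 2 ^ (2 * n)" "D_S < 2 ^ (2 * n)"
  shows "[int (residue_output n D_C D_S) + 1 =
     int (low_half n D_C) - int (high_half n D_C)
       + int (low_half n D_S) - int (high_half n D_S)] (mod 2 ^ n + 1)"
proof -
  obtain a b where ab:
    "csa_stage n (low_half n D_C) (complement n (high_half n D_C)) (low_half n D_S) = (a, b)"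
    by fastforce
  obtain c d where cd: "csa_stage n a b (complement n (high_half n D_S)) = (c, d)"
    by fastforce
  have out: "residue_output n D_C D_S = final_adder n c d"
    by (simp add: residue_output_def ab cd)
  note ab_less = csa_stage_less[OF n ab] and cd_less = csa_stage_less[OF n cd]
  let ?V = "int (low_half n D_C) - int (high_half n D_C)
    + int (low_half n D_S) - int (high_half n D_S)"
  have 1: "2 ^ n + 1 dvd int a + int b - (int (low_half n D_C) + (2 ^ n - 1 - int (high_half n D_C))
      + int (low_half n D_S) + 1)"
    using csa_stage_cong[OF n low_half_less complement_less low_half_less ab] assms(2)
    by (simp add: cong_iff_dvd_diff int_complement high_half_less)
  have 2: "2 ^ n + 1 dvd int c + int d - (int a + int b + (2 ^ n - 1 - int (high_half n D_S)) + 1)"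
    using csa_stage_cong[OF n ab_less complement_less cd] assms(3)
    by (simp add: cong_iff_dvd_diff int_complement high_half_less)
  have 3: "2 ^ n + 1 dvd int (final_adder n c d) - (int c + int d + 1)"
    using final_adder_cong[OF cd_less] by (simp add: cong_iff_dvd_diff)
  \<comment> \<open>The differences in 1, 2 and 3 telescope to
    \<open>int (final_adder n c d) - ?V - 2 * 2 ^ n - 1\<close>; adding twice the modulus turns the
    constant part into \<open>+ 1\<close>.\<close>
  have "2 ^ n + 1 dvd 2 * (2 ^ n + 1 :: int)" by (rule dvd_triv_right)
  from dvd_add[OF dvd_add[OF dvd_add[OF 1 2] 3] this]
  have "2 ^ n + 1 dvd int (final_adder n c d) + 1 - ?V"
    by (simp add: algebra_simps)
  then show ?thesis by (simp add: cong_iff_dvd_diff out)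
qed

section \<open>Block expansion and the adder tree\<close>

lemma sum_base_digits:
  fixes X B :: nat
  shows "(\<Sum>j<q. B ^ j * ((X div B ^ j) mod B)) = X mod B ^ q"
proof (induction q)
  case (Suc q)
  then show ?case by (simp only: sum.lessThan_Suc power_Suc2 mod_mult2_eq add.commute)
qed simp

text \<open>Casting out nines in base \<open>2 ^ (2 * n)\<close>: the base is congruent to 1, so a
  number is congruent to its digit sum.\<close>

lemma sum_blocks_cong:
  assumes "X < 2 ^ (2 * n * q)"
  shows "[int (\<Sum>j<q. block n X j) = int X] (mod 2 ^ (2 * n) - 1)"
proof -
  have "X = (\<Sum>j<q. (2 ^ (2 * n)) ^ j * block n X j)"
    using sum_base_digits[of "2 ^ (2 * n)" X q] assms by (simp add: block_def power_mult)
  then have "int X = (\<Sum>j<q. (2 ^ (2 * n)) ^ j * int (block n X j))"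
    by (metis (mono_tags, lifting) of_nat_mult of_nat_numeral of_nat_power of_nat_sum sum.cong)
  moreover have "[1 = (2 :: int) ^ (2 * n)] (mod 2 ^ (2 * n) - 1)"
    by (subst cong_sym_eq) (simp add: cong_iff_dvd_diff)
  \<comment> \<open>The factor \<open>1 ^ j\<close> gives both sides the same shape, so the
    congruence rules apply termwise.\<close>
  then have "[1 ^ j * int (block n X j) = (2 ^ (2 * n)) ^ j * int (block n X j)]
      (mod 2 ^ (2 * n) - 1)" for j
    by (intro cong_mult cong_pow cong_refl)
  then have "[(\<Sum>j<q. 1 ^ j * int (block n X j)) = (\<Sum>j<q. (2 ^ (2 * n)) ^ j * int (block n X j))]
      (mod 2 ^ (2 * n) - 1)"
    by (intro cong_sum)
  ultimately show ?thesis by simp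
qed

text \<open>Rounding up ensures that the blocks cover all \<open>p\<close> bits, so the expansion of
  \<open>X\<close> loses nothing.\<close>

lemma le_num_blocks:
  assumes "n \<ge> 1"
  shows "p \<le> 2 * n * num_blocks n p"
proof -
  have "real p / real (2 * n) \<le> real (num_blocks n p)"
    unfolding num_blocks_def by (rule real_nat_ceiling_ge)
  then have "real p \<le> real (2 * n * num_blocks n p)"
    using assms by (simp add: divide_le_eq mult.commute mult.left_commute)
  then show ?thesis by (simp only: of_nat_le_iff)
qed

lemma halves_cong:
  "[int D = int (low_half n D) - int (high_half n D)] (mod 2 ^ n + 1)"
proof -
  have "int D = int (2 ^ n * high_half n D + low_half n D)"
    by (simp only: high_half_def low_half_def mult_div_mod_eq)
  then have "int D = int (low_half n D) - int (high_half n D) + (2 ^ n + 1) * int (high_half n D)"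
    by (simp add: algebra_simps)
  then show ?thesis by (simp add: cong_def)
qed

text \<open>The tree works modulo \<open>2 ^ (2 * n) - 1\<close>, a multiple of
  \<open>2 ^ n + 1\<close>, so its congruence descends to the smaller modulus, where each output
  splits into halves.\<close>

lemma csa_tree_cong:
  assumes "n \<ge> 1" "X < 2 ^ p" "csa_tree n p X D_C D_S"
  shows "[int X = int (low_half n D_C) - int (high_half n D_C)
             + (int (low_half n D_S) - int (high_half n D_S))] (mod 2 ^ n + 1)"
proof -
  have "X < 2 ^ (2 * n * num_blocks n p)"
    using assms(2) le_num_blocks[OF assms(1)]
    by (meson less_le_trans power_increasing one_le_numeral)
  from sum_blocks_cong[OF this] assms(3)
  have "[int X = int (D_C + D_S)] (mod 2 ^ (2 * n) - 1)"
    by (simp add: csa_tree_def cong_def)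
  moreover have "(2 :: int) ^ (2 * n) - 1 = (2 ^ n + 1) * (2 ^ n - 1)"
    unfolding power_even_eq power2_eq_square by (simp add: algebra_simps)
  ultimately have "[int X = int D_C + int D_S] (mod 2 ^ n + 1)"
    by (metis cong_dvd_modulus dvd_triv_left of_nat_add)
  also have "[int D_C + int D_S = int (low_half n D_C) - int (high_half n D_C)
             + (int (low_half n D_S) - int (high_half n D_S))] (mod 2 ^ n + 1)"
    by (intro cong_add halves_cong)
  finally show ?thesis .
qed

theorem theorem1:
  fixes n p X D_C D_S :: nat
  assumes "n \<ge> 1" and "p \<ge> 4 * n" and "X < 2 ^ p"
    and "csa_tree n p X D_C D_S"
  shows "int X mod (2 ^ n + 1) =
           (int (low_half n D_C) - int (high_half n D_C)
             + int (low_half n D_S) - int (high_half n D_S)) mod (2 ^ n + 1)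
       \<and> (int (low_half n D_C) - int (high_half n D_C)
             + int (low_half n D_S) - int (high_half n D_S)) mod (2 ^ n + 1) =
           (int (residue_output n D_C D_S) + 1) mod (2 ^ n + 1)
       \<and> (int X - 1) mod (2 ^ n + 1) = int (residue_output n D_C D_S)"
proof -
  let ?V = "int (low_half n D_C) - int (high_half n D_C)
    + int (low_half n D_S) - int (high_half n D_S)"
  let ?R = "int (residue_output n D_C D_S)"
  have X: "[int X = ?V] (mod 2 ^ n + 1)"
    using csa_tree_cong[OF assms(1,3,4)] by (simp add: add_diff_eq)
  have R: "[?R + 1 = ?V] (mod 2 ^ n + 1)"
    using assms(1,4) by (intro residue_output_cong) (auto simp: csa_tree_def)
  have "[int X - 1 = ?R + 1 - 1] (mod 2 ^ n + 1)"
    by (intro cong_diff cong_refl cong_trans[OF X cong_sym[OF R]])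
  \<comment> \<open>This makes \<open>?R\<close> its own residue, turning the congruence into an
    equality.\<close>
  moreover have "?R \<le> 2 ^ n"
    using residue_output_le[OF assms(1), of D_C D_S] by (simp flip: of_nat_le_iff)
  ultimately have "(int X - 1) mod (2 ^ n + 1) = ?R"
    by (simp add: cong_def)
  with X R show ?thesis by (simp add: cong_def)
qed

end
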